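(* Any disagreement bound $f$ satisfies $$f\left(1-\tfrac1n\right)\ge \frac{2n-2}{2n-1}\qquad\text{for every integer } n\ge2.$$ (Here $\frac{2n-2}{2n-1}=F(1-\frac1n)$ with $F(x)=\frac{2x}{1+x}$.)
   Context: A coupling of a collection of random variables $(X_i)_{i\in I}$ is a family $(X_i')_{i\in I}$ of random variables on one common probability space such that each $X_i'$ has the same law as $X_i$; primes are omitted. The total variation distance is $d_{\mathrm{TV}}(X,Y)=\sup_A|\mathbb P(X\in A)-\mathbb P(Y\in A)|$, over all measurable sets $A$. A function $f:[0,1]\to[0,1]$ is called a disagreement bound if for any finite collection of random variables there is a coupling of the variables such that any two of them, say $X$ and $Y$, satisfy $\mathbb P(X\neq Y)\le f(d_{\mathrm{TV}}(X,Y))$. *)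

theory Defs
  imports "HOL-Probability.Probability"
begin

text \<open>
  A random variable is a pair of a probability space \<open>P\<close> and a measurable map \<open>X\<close> from \<open>P\<close> to a
  state space \<open>S\<close>. Only the carrier and the sigma-algebra of \<open>S\<close> matter, not its measure.
  Different random variables of a collection may live on different probability spaces.
\<close>

definition tv_dist ::
  "'a measure \<Rightarrow> 'p measure \<Rightarrow> ('p \<Rightarrow> 'a) \<Rightarrow> 'q measure \<Rightarrow> ('q \<Rightarrow> 'a) \<Rightarrow> real" where
  "tv_dist S P X Q Y =
     (SUP A\<in>sets S. \<bar>measure P (X -` A \<inter> space P) - measure Q (Y -` A \<inter> space Q)\<bar>)"

definition is_coupling ::
  "'a measure \<Rightarrow> 'i set \<Rightarrow> ('i \<Rightarrow> 'p measure) \<Rightarrow> ('i \<Rightarrow> 'p \<Rightarrow> 'a) \<Rightarrow>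
   'q measure \<Rightarrow> ('i \<Rightarrow> 'q \<Rightarrow> 'a) \<Rightarrow> bool" where
  "is_coupling S I P X Q X' \<longleftrightarrow>
     prob_space Q \<and>
     (\<forall>i\<in>I. X' i \<in> measurable Q S \<and> distr Q S (X' i) = distr (P i) S (X i))"

text \<open>
  For the event \<open>X \<noteq> Y\<close> to be measurable for all \<open>S\<close>-valued \<open>X\<close>, \<open>Y\<close>, the diagonal has to belong
  to the product sigma-algebra.
\<close>

definition measurable_diagonal :: "'a measure \<Rightarrow> bool" where
  "measurable_diagonal S \<longleftrightarrow> {(x, y). x \<in> space S \<and> y \<in> space S \<and> x = y} \<in> sets (S \<Otimes>\<^sub>M S)"

text \<open>
  HOL does not allow quantification over types inside a predicate, so the definition below names
  concrete types; none of them restricts generality.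
  A measurable diagonal forces countably many measurable sets to separate the points of \<open>S\<close>, so
  \<open>S\<close> has at most continuum many points and is isomorphic, as a measurable space, to one whose
  carrier is a set of reals.
  The notion depends on the given variables only through their laws on \<open>S\<close>, and each law is that
  of the identity map on \<open>S\<close> with the law as measure, so probability spaces on subsets of the reals
  suffice for them.
  For the coupling, the probability space may be taken to be the product of copies of \<open>S\<close> with the
  joint law, whose points are functions from indices to reals.
\<close>

definition disagreement_bound :: "(real \<Rightarrow> real) \<Rightarrow> bool" where
  "disagreement_bound f \<longleftrightarrow>
     f \<in> {0..1} \<rightarrow> {0..1} \<and>
     (\<forall>(S :: real measure) (I :: nat set) (P :: nat \<Rightarrow> real measure) (X :: nat \<Rightarrow> real \<Rightarrow> real).
        measurable_diagonal S \<and> finite I \<and>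
        (\<forall>i\<in>I. prob_space (P i) \<and> X i \<in> measurable (P i) S) \<longrightarrow>
        (\<exists>(Q :: (nat \<Rightarrow> real) measure) (X' :: nat \<Rightarrow> (nat \<Rightarrow> real) \<Rightarrow> real).
           is_coupling S I P X Q X' \<and>
           (\<forall>i\<in>I. \<forall>j\<in>I. i \<noteq> j \<longrightarrow>
              measure Q {\<omega> \<in> space Q. X' i \<omega> \<noteq> X' j \<omega>}
                \<le> f (tv_dist S (P i) (X i) (P j) (X j)))))"

definition F :: "real \<Rightarrow> real" where
  "F x = 2 * x / (1 + x)"

end

theory Submission imports Defs begin

text \<open>
  Put \<open>n = m + 1\<close> and couple the uniform laws on all \<open>n\<close>-subsets of an \<open>N\<close>-point set. Laws on sets
  meeting in exactly one point have distance \<open>1 - 1/n\<close>. In every outcome the coupling selects a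
  point \<open>c A \<in> A\<close> of each \<open>A\<close>; if \<open>a p\<close> sets select \<open>p\<close>, then at most \<open>\<Sum>p. (a p)\<^sup>2\<close> ordered pairs agree.
  Enumerate the points by increasing \<open>a\<close>. A set whose last point is the \<open>i\<close>-th one (from 0) satisfies
  \<open>a (c A) \<le> a i\<close>, and there are \<open>i choose m\<close> such sets, so
  \<open>\<Sum>p. (a p)\<^sup>2 = \<Sum>A. a (c A) \<le> \<Sum>i. (i choose m) * a i\<close>, and by AM-GM this gives
  \<open>\<Sum>p. (a p)\<^sup>2 \<le> \<Sum>i<N. (i choose m)\<^sup>2\<close>. As \<open>N\<close> grows, the ratio of this bound to the number of
  ordered pairs meeting in one point tends to \<open>1 / (2m + 1) = 1 / (2n - 1)\<close>, which bounds the
  average agreement probability over such pairs.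
\<close>

section \<open>Subsets of a fixed size and agreeing selections\<close>

definition subsets_of_card :: "'a set \<Rightarrow> nat \<Rightarrow> 'a set set" where
  "subsets_of_card V k = {A. A \<subseteq> V \<and> card A = k}"

lemma finite_subsets_of_card: "finite V \<Longrightarrow> finite (subsets_of_card V k)"
  unfolding subsets_of_card_def by (rule finite_subset[of _ "Pow V"]) auto

lemma card_subsets_of_card: "finite V \<Longrightarrow> card (subsets_of_card V k) = card V choose k"
  unfolding subsets_of_card_def by (rule n_subsets)

text \<open>Points are inserted in increasing order of \<open>a\<close>, so a choice made by a set
  through the newest point \<open>x\<close> has value at most \<open>a x\<close>; AM-GM then
  separates \<open>a x\<close> from the number of such sets. The factor 2 is chosen with an
  application in mind: when \<open>a\<close> counts choices, the left side is twice the sum of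
  squares on the right, and one copy cancels.\<close>

lemma sum_choice_le:
  fixes a :: "'a \<Rightarrow> real"
  assumes "finite V" and "\<And>A. A \<in> subsets_of_card V (Suc m) \<Longrightarrow> c A \<in> A"
  shows "2 * (\<Sum>A\<in>subsets_of_card V (Suc m). a (c A))
           \<le> (\<Sum>p\<in>V. (a p)\<^sup>2) + (\<Sum>i<card V. (real (i choose m))\<^sup>2)"
  using assms
proof (induction V rule: finite_ranking_induct[where f = a])
  case empty
  have "subsets_of_card ({} :: 'a set) (Suc m) = {}" by (auto simp: subsets_of_card_def)
  then show ?case by simp
next
  case (insert x V)
  show ?case
  \<comment> \<open>The ranking induction does not guarantee that the inserted point is new.\<close>
  proof (cases "x \<in> V")
    case True
    then show ?thesis using insert by (simp add: insert_absorb)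
  next
    case False
    let ?C = "insert x ` subsets_of_card V m"
    have fin: "A \<in> subsets_of_card V k \<Longrightarrow> finite A" for A k
      using insert(1) finite_subset by (auto simp: subsets_of_card_def)
    have split: "subsets_of_card (insert x V) (Suc m) = subsets_of_card V (Suc m) \<union> ?C"
    proof (intro equalityI subsetI)
      fix A assume A: "A \<in> subsets_of_card (insert x V) (Suc m)"
      show "A \<in> subsets_of_card V (Suc m) \<union> ?C"
      proof (cases "x \<in> A")
        case True
        have "A - {x} \<in> subsets_of_card V m"
          using A True by (auto simp: subsets_of_card_def)
        moreover have "A = insert x (A - {x})" using True by auto
        ultimately show ?thesis by blast
      next
        case False
        then show ?thesis using A by (auto simp: subsets_of_card_def)
      qed
    next
      fix A assume "A \<in> subsets_of_card V (Suc m) \<union> ?C"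
      then show "A \<in> subsets_of_card (insert x V) (Suc m)"
      proof
        assume "A \<in> ?C"
        then obtain B where B: "B \<in> subsets_of_card V m" "A = insert x B" by auto
        have "x \<notin> B" using B(1) False by (auto simp: subsets_of_card_def)
        then show ?thesis using B fin[OF B(1)] by (auto simp: subsets_of_card_def)
      qed (auto simp: subsets_of_card_def)
    qed
    have "inj_on (insert x) (subsets_of_card V m)"
    proof (rule inj_onI)
      fix A B
      assume "A \<in> subsets_of_card V m" "B \<in> subsets_of_card V m" "insert x A = insert x B"
      moreover from this have "x \<notin> A" "x \<notin> B" using False by (auto simp: subsets_of_card_def)
      ultimately show "A = B" by (simp add: insert_ident)
    qed
    then have card: "card ?C = card V choose m"
      using insert(1) by (simp add: card_image card_subsets_of_card)
    have "(\<Sum>A\<in>?C. a (c A)) \<le> (\<Sum>A\<in>?C. a x)"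
    proof (rule sum_mono)
      fix A assume A: "A \<in> ?C"
      then have "c A \<in> A" using insert.prems split by blast
      moreover have "A \<subseteq> insert x V" using A by (auto simp: subsets_of_card_def)
      ultimately show "a (c A) \<le> a x" using insert.hyps by blast
    qed
    also have "\<dots> = real (card V choose m) * a x" by (simp add: card)
    finally have "2 * (\<Sum>A\<in>?C. a (c A)) \<le> 2 * (real (card V choose m) * a x)" by simp
    also have "\<dots> \<le> (a x)\<^sup>2 + (real (card V choose m))\<^sup>2"
      using sum_squares_bound[of "real (card V choose m)" "a x"] by simp
    finally have new: "2 * (\<Sum>A\<in>?C. a (c A)) \<le> (a x)\<^sup>2 + (real (card V choose m))\<^sup>2" .
    have "(\<Sum>A\<in>subsets_of_card (insert x V) (Suc m). a (c A))
            = (\<Sum>A\<in>subsets_of_card V (Suc m). a (c A)) + (\<Sum>A\<in>?C. a (c A))"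
      unfolding split
    proof (rule sum.union_disjoint)
      show "subsets_of_card V (Suc m) \<inter> ?C = {}"
        using False by (auto simp: subsets_of_card_def)
    qed (use insert(1) finite_subsets_of_card in auto)
    moreover have "2 * (\<Sum>A\<in>subsets_of_card V (Suc m). a (c A))
        \<le> (\<Sum>p\<in>V. (a p)\<^sup>2) + (\<Sum>i<card V. (real (i choose m))\<^sup>2)"
      using insert.IH insert.prems split by blast
    ultimately show ?thesis using new False insert(1) by simp
  qed
qed

text \<open>With \<open>a p\<close> the number of sets selecting \<open>p\<close>, each
  \<open>A\<close> agrees with exactly \<open>a (c A)\<close> sets, itself included. Grouping the
  sets by selected point turns the sum of these numbers into the sum of the squares of
  \<open>a\<close>.\<close>

lemma card_agreeing_pairs_le:
  assumes "finite V" and "\<And>A. A \<in> subsets_of_card V (Suc m) \<Longrightarrow> c A \<in> A"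
  shows "real (card {(A, B). A \<in> subsets_of_card V (Suc m) \<and> B \<in> subsets_of_card V (Suc m) \<and> c A = c B})
           \<le> (\<Sum>i<card V. (real (i choose m))\<^sup>2)"
proof -
  let ?S = "subsets_of_card V (Suc m)"
  define a where "a p = real (card {A \<in> ?S. c A = p})" for p
  have finS: "finite ?S" using assms(1) by (rule finite_subsets_of_card)
  have cV: "c A \<in> V" if "A \<in> ?S" for A
    using assms(2)[OF that] that by (auto simp: subsets_of_card_def)
  have "{(A, B). A \<in> ?S \<and> B \<in> ?S \<and> c A = c B} = (SIGMA A:?S. {B \<in> ?S. c B = c A})"
    by auto
  then have pairs: "real (card {(A, B). A \<in> ?S \<and> B \<in> ?S \<and> c A = c B}) = (\<Sum>A\<in>?S. a (c A))"
    using finS by (simp add: a_def)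
  have "(\<Sum>A\<in>?S. a (c A)) = (\<Sum>p\<in>V. \<Sum>A\<in>{A \<in> ?S. c A = p}. a (c A))"
    using finS assms(1) cV by (intro sum.group[symmetric]) auto
  also have "\<dots> = (\<Sum>p\<in>V. (a p)\<^sup>2)"
    by (intro sum.cong) (auto simp: a_def power2_eq_square)
  finally show ?thesis
    using sum_choice_le[of V m c a, OF assms] pairs by linarith
qed

section \<open>Counting pairs that meet in one point\<close>

text \<open>A common point \<open>p\<close> in \<open>A\<close> and \<open>m\<close> further points
  outside \<open>A\<close> give a set meeting \<open>A\<close> only in \<open>p\<close>. Both
  ingredients can be read off from \<open>insert p D\<close> by intersecting with \<open>A\<close>
  and removing \<open>A\<close>, hence injectivity.\<close>

lemma card_subsets_meeting_once_ge:
  assumes "finite V" and "A \<in> subsets_of_card V (Suc m)"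
  shows "Suc m * (card V - Suc m choose m)
           \<le> card {B \<in> subsets_of_card V (Suc m). card (A \<inter> B) = 1}"
proof -
  let ?T = "{B \<in> subsets_of_card V (Suc m). card (A \<inter> B) = 1}"
  let ?D = "subsets_of_card (V - A) m"
  have A: "A \<subseteq> V" "card A = Suc m" "finite A"
    using assms finite_subset by (auto simp: subsets_of_card_def)
  have inj: "inj_on (\<lambda>(p, D). insert p D) (A \<times> ?D)"
  proof (rule inj_onI, clarify)
    fix p D p' D'
    assume p: "p \<in> A" "p' \<in> A" and D: "D \<in> ?D" "D' \<in> ?D" and eq: "insert p D = insert p' D'"
    have "insert p D \<inter> A = {p}" "insert p D - A = D" "insert p' D' \<inter> A = {p'}" "insert p' D' - A = D'"
      using p D by (auto simp: subsets_of_card_def)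
    with eq show "p = p' \<and> D = D'" by auto
  qed
  have "(\<lambda>(p, D). insert p D) ` (A \<times> ?D) \<subseteq> ?T"
  proof clarify
    fix p D assume p: "p \<in> A" and D: "D \<in> ?D"
    have "finite D" "p \<notin> D" "card D = m" "D \<subseteq> V"
      using D p assms(1) finite_subset[of D "V - A"] by (auto simp: subsets_of_card_def)
    moreover have "A \<inter> insert p D = {p}" using p D by (auto simp: subsets_of_card_def)
    ultimately show "insert p D \<in> subsets_of_card V (Suc m) \<and> card (A \<inter> insert p D) = 1"
      using p A by (auto simp: subsets_of_card_def)
  qed
  then have "card (A \<times> ?D) \<le> card ?T"
    using card_inj_on_le[OF inj] assms(1) finite_subsets_of_card[of V] by auto
  moreover have "card (A \<times> ?D) = Suc m * (card V - Suc m choose m)"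
    using A assms(1) by (simp add: card_cartesian_product card_subsets_of_card card_Diff_subset)
  ultimately show ?thesis by simp
qed

lemma card_pairs_meeting_once_ge:
  assumes "finite V"
  shows "card V * (card V - 1 choose m) * (card V - Suc m choose m)
    \<le> card {(A, B). A \<in> subsets_of_card V (Suc m) \<and> B \<in> subsets_of_card V (Suc m) \<and> card (A \<inter> B) = 1}"
proof -
  let ?S = "subsets_of_card V (Suc m)"
  have finS: "finite ?S" using assms by (rule finite_subsets_of_card)
  have "{(A, B). A \<in> ?S \<and> B \<in> ?S \<and> card (A \<inter> B) = 1} = (SIGMA A:?S. {B \<in> ?S. card (A \<inter> B) = 1})"
    by auto
  then have "card {(A, B). A \<in> ?S \<and> B \<in> ?S \<and> card (A \<inter> B) = 1}
      = (\<Sum>A\<in>?S. card {B \<in> ?S. card (A \<inter> B) = 1})"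
    using finS by simp
  also have "\<dots> \<ge> (\<Sum>A\<in>?S. Suc m * (card V - Suc m choose m))"
    using assms by (intro sum_mono card_subsets_meeting_once_ge)
  also have "(\<Sum>A\<in>?S. Suc m * (card V - Suc m choose m))
      = (Suc m * (card V choose Suc m)) * (card V - Suc m choose m)"
    using assms by (simp add: card_subsets_of_card algebra_simps)
  \<comment> \<open>The absorption identity leaves only binomials with lower index \<open>m\<close>,
    as in the bound on agreeing pairs.\<close>
  also have "Suc m * (card V choose Suc m) = card V * (card V - 1 choose m)"
    by (cases "card V") (use Suc_times_binomial in auto)
  finally show ?thesis .
qed

section \<open>Estimates for power sums and binomial coefficients\<close>

text \<open>A discrete form of comparing the sum with the integral of \<open>x ^ k\<close> from 0 to
  \<open>N\<close>. The inductive step keeps the first two terms of the binomial expansion of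
  \<open>(N + 1) ^ Suc k\<close>.\<close>

lemma sum_powers_le: "real (Suc k) * (\<Sum>i<N. real i ^ k) \<le> real N ^ Suc k"
proof (induction N)
  case (Suc N)
  have "real N ^ Suc k + real (Suc k) * real N ^ k \<le> real (Suc N) ^ Suc k"
  proof (induction k)
    case (Suc k)
    have "real N ^ Suc (Suc k) + real (Suc (Suc k)) * real N ^ Suc k
        \<le> (real N ^ Suc k + real (Suc k) * real N ^ k) * real (Suc N)"
      by (simp add: algebra_simps)
    also have "\<dots> \<le> real (Suc N) ^ Suc k * real (Suc N)"
      by (intro mult_right_mono Suc.IH) simp
    finally show ?case by (simp add: mult.commute)
  qed simp
  with Suc show ?case by (simp add: algebra_simps)
qed simp

text \<open>The right side is the product of \<open>k + 1\<close>, ..., \<open>k + m\<close>, and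
  each factor is at least \<open>k\<close>.\<close>

lemma power_le_fact_times_binomial: "k ^ m \<le> fact m * (m + k choose m)"
proof (induction m)
  case (Suc m)
  have "k ^ Suc m \<le> (Suc m + k) * (fact m * (m + k choose m))"
    using mult_mono[OF _ Suc.IH, of k "Suc m + k"] by simp
  also have "\<dots> = fact m * (Suc m * (Suc (m + k) choose Suc m))"
    by (subst Suc_times_binomial) (simp add: algebra_simps)
  finally show ?case by (simp add: algebra_simps)
qed simp

lemma binomial_mono_left: "n \<le> n' \<Longrightarrow> n choose k \<le> n' choose k"
proof (rule lift_Suc_mono_le[of "\<lambda>n. n choose k"])
  show "n choose k \<le> Suc n choose k" for n by (cases k) auto
qed

text \<open>The falling factorial \<open>fact m * (i choose m)\<close> is at most
  \<open>i ^ m\<close>, so the power sum with exponent \<open>2 * m\<close> applies. It supplies the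
  constant \<open>2 * m + 1\<close>, which is \<open>2 * n - 1\<close> for
  \<open>n = m + 1\<close>.\<close>

lemma sum_binomial_squared_le:
  "(2 * real m + 1) * (\<Sum>i<N. (fact m * real (i choose m))\<^sup>2) \<le> real N ^ Suc (2 * m)"
proof -
  have "(fact m * real (i choose m))\<^sup>2 \<le> real i ^ (2 * m)" for i
  proof -
    have "real ((i choose m) * fact m) \<le> real (i ^ m)"
      using binomial_fact_pow[of i m] of_nat_mono by blast
    then have "fact m * real (i choose m) \<le> real i ^ m" by (simp add: mult.commute)
    then have "(fact m * real (i choose m))\<^sup>2 \<le> (real i ^ m)\<^sup>2" by (intro power_mono) auto
    then show ?thesis by (simp add: power_mult[symmetric] mult.commute)
  qed
  then have "(2 * real m + 1) * (\<Sum>i<N. (fact m * real (i choose m))\<^sup>2)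
      \<le> (2 * real m + 1) * (\<Sum>i<N. real i ^ (2 * m))"
    by (intro mult_left_mono sum_mono) auto
  also have "\<dots> \<le> real N ^ Suc (2 * m)" using sum_powers_le[of "2 * m" N] by (simp add: algebra_simps)
  finally show ?thesis .
qed

section \<open>From counting to probabilities and distances\<close>

text \<open>The sum is the expected number of agreeing pairs in \<open>W\<close>. For almost every
  outcome \<open>\<omega>\<close>, the map sending \<open>A\<close> to \<open>X A \<omega>\<close>
  is a selection, so the counting bound holds pointwise and survives integration.\<close>

lemma sum_prob_agree_le:
  fixes V :: "real set"
  assumes "prob_space Q" and "finite V"
    and rv: "\<And>A. A \<in> subsets_of_card V (Suc m) \<Longrightarrow> X A \<in> borel_measurable Q"
    and mem: "\<And>A. A \<in> subsets_of_card V (Suc m) \<Longrightarrow> AE \<omega> in Q. X A \<omega> \<in> A"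
    and sub: "W \<subseteq> subsets_of_card V (Suc m) \<times> subsets_of_card V (Suc m)"
  shows "(\<Sum>(A, B)\<in>W. measure Q {\<omega> \<in> space Q. X A \<omega> = X B \<omega>})
           \<le> (\<Sum>i<card V. (real (i choose m))\<^sup>2)"
proof -
  interpret prob_space Q by fact
  let ?S = "subsets_of_card V (Suc m)"
  let ?E = "\<lambda>A B. {\<omega> \<in> space Q. X A \<omega> = X B \<omega>}"
  have finS: "finite ?S" using assms(2) by (rule finite_subsets_of_card)
  have finW: "finite W" using sub finS finite_subset by blast
  have E: "?E A B \<in> sets Q" if "(A, B) \<in> W" for A B
  proof -
    have [measurable]: "X A \<in> borel_measurable Q" "X B \<in> borel_measurable Q"
      using that sub rv by auto
    show ?thesis by measurable
  qed
  have int: "integrable Q (indicat_real (?E A B))" if "(A, B) \<in> W" for A B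
    using E[OF that] by (simp add: integrable_indicator_iff emeasure_eq_measure)
  have "(\<Sum>(A, B)\<in>W. prob (?E A B)) = (\<Sum>(A, B)\<in>W. \<integral>\<omega>. indicator (?E A B) \<omega> \<partial>Q)"
    using E by (intro sum.cong) auto
  also have "\<dots> = (\<integral>\<omega>. (\<Sum>(A, B)\<in>W. indicator (?E A B) \<omega>) \<partial>Q)"
    using int by (subst Bochner_Integration.integral_sum) (auto simp: case_prod_beta)
  also have "\<dots> \<le> (\<integral>\<omega>. (\<Sum>i<card V. (real (i choose m))\<^sup>2) \<partial>Q)"
  proof (rule integral_mono_AE)
    show "integrable Q (\<lambda>\<omega>. \<Sum>(A, B)\<in>W. indicat_real (?E A B) \<omega>)"
      using int by (intro Bochner_Integration.integrable_sum) auto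
    have "AE \<omega> in Q. \<forall>A\<in>?S. X A \<omega> \<in> A" using mem finS by (intro AE_finite_allI) auto
    then show "AE \<omega> in Q. (\<Sum>(A, B)\<in>W. indicator (?E A B) \<omega>) \<le> (\<Sum>i<card V. (real (i choose m))\<^sup>2)"
    proof eventually_elim
      case (elim \<omega>)
      have "(\<Sum>(A, B)\<in>W. indicat_real (?E A B) \<omega>)
          \<le> (\<Sum>w\<in>W. indicator {(A, B). X A \<omega> = X B \<omega>} w)"
        by (intro sum_mono) (auto simp: indicator_def)
      also have "\<dots> = real (card (W \<inter> {(A, B). X A \<omega> = X B \<omega>}))"
        using finW by (simp add: indicator_def of_bool_def sum.If_cases)
      also have "\<dots> \<le> real (card {(A, B). A \<in> ?S \<and> B \<in> ?S \<and> X A \<omega> = X B \<omega>})"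
        using sub finS by (intro of_nat_mono card_mono) (auto intro: finite_subset[of _ "?S \<times> ?S"])
      also have "\<dots> \<le> (\<Sum>i<card V. (real (i choose m))\<^sup>2)"
        using elim by (intro card_agreeing_pairs_le assms(2)) auto
      finally show ?case .
    qed
  qed simp
  finally show ?thesis by (simp add: prob_space)
qed

text \<open>The supremum is attained at the event \<open>A\<close>, with masses 1 and
  \<open>1 / n\<close>. For any event, the two counts differ by at most the \<open>n - 1\<close>
  points of one set outside the other; \<open>diff\<close> is used in both orders because of the
  absolute value.\<close>

lemma tv_dist_uniform:
  fixes A B :: "real set"
  assumes "finite A" "finite B" "card A = n" "card B = n" "card (A \<inter> B) = 1"
  shows "tv_dist borel (measure_pmf (pmf_of_set A)) (\<lambda>x. x) (measure_pmf (pmf_of_set B)) (\<lambda>x. x)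
           = 1 - 1 / real n"
proof -
  have ne: "A \<noteq> {}" "B \<noteq> {}" using assms(5) by auto
  have n: "0 < n" using assms(1,3) ne by (simp add: card_gt_0_iff flip: assms(3))
  have diff: "card (A' \<inter> T) + 1 \<le> n + card (B' \<inter> T)"
    if "finite A'" "finite B'" "card A' = n" "card (A' \<inter> B') = 1" for A' B' T :: "real set"
  proof -
    have "card (A' \<inter> T) \<le> card ((A' - B') \<union> (B' \<inter> T))"
      using that by (intro card_mono) auto
    also have "\<dots> \<le> card (A' - B') + card (B' \<inter> T)" by (rule card_Un_le)
    also have "card (A' - B') = n - 1"
      using that by (simp add: card_Diff_subset_Int)
    finally show ?thesis using n by linarith
  qed
  have P: "measure (measure_pmf (pmf_of_set C)) ((\<lambda>x. x) -` T \<inter> space (measure_pmf (pmf_of_set C)))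
      = real (card (C \<inter> T)) / real n" if "finite C" "C \<noteq> {}" "card C = n" for C T :: "real set"
    using that by (simp add: measure_pmf_of_set)
  show ?thesis
    unfolding tv_dist_def P[OF assms(1) ne(1) assms(3)] P[OF assms(2) ne(2) assms(4)]
  proof (rule cSup_eq_maximum)
    have "A \<in> sets borel" using assms(1) by (simp add: borel_closed finite_imp_closed)
    moreover have "1 - 1 / real n = \<bar>real (card (A \<inter> A)) / real n - real (card (B \<inter> A)) / real n\<bar>"
      using assms n by (simp add: Int_commute field_simps)
    ultimately show "1 - 1 / real n
        \<in> (\<lambda>T. \<bar>real (card (A \<inter> T)) / real n - real (card (B \<inter> T)) / real n\<bar>) ` sets borel"
      by blast
  next
    fix x assume "x \<in> (\<lambda>T. \<bar>real (card (A \<inter> T)) / real n - real (card (B \<inter> T)) / real n\<bar>) ` sets borel"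
    then obtain T where x: "x = \<bar>real (card (A \<inter> T)) / real n - real (card (B \<inter> T)) / real n\<bar>" by auto
    have "\<bar>real (card (A \<inter> T)) - real (card (B \<inter> T))\<bar> \<le> real n - 1"
      using diff[of A B T] diff[of B A T] assms by (simp add: Int_commute)
    then have "\<bar>real (card (A \<inter> T)) - real (card (B \<inter> T))\<bar> / real n \<le> (real n - 1) / real n"
      by (intro divide_right_mono) auto
    then show "x \<le> 1 - 1 / real n"
      using n by (simp add: x diff_divide_distrib[symmetric] abs_divide) (simp add: diff_divide_distrib)
  qed
qed

lemma measurable_diagonal_borel: "measurable_diagonal (borel :: real measure)"
proof -
  have "{(x, y). x = y} = {z :: real \<times> real. fst z = snd z}" by auto
  moreover have "closed {z :: real \<times> real. fst z = snd z}"
    by (intro closed_Collect_eq continuous_intros)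
  ultimately show ?thesis
    unfolding measurable_diagonal_def borel_prod by (simp add: borel_closed)
qed

section \<open>Consequences for a disagreement bound\<close>

text \<open>Couple the uniform laws on all \<open>Suc m\<close>-subsets of \<open>V\<close>. Every
  pair meeting in one point agrees with probability at least
  \<open>1 - f (1 - 1 / real (Suc m))\<close>, and the total agreement probability is bounded by
  counting.\<close>

lemma disagreement_bound_counting:
  fixes V :: "real set"
  assumes f: "disagreement_bound f" and V: "finite V" and m: "m > 0"
  shows "(1 - f (1 - 1 / real (Suc m))) * (real (card V) * real (card V - 1 choose m) * real (card V - Suc m choose m))
           \<le> (\<Sum>i<card V. (real (i choose m))\<^sup>2)"
proof -
  let ?S = "subsets_of_card V (Suc m)"
  let ?g = "1 - f (1 - 1 / real (Suc m))"
  have finS: "finite ?S" using V by (rule finite_subsets_of_card)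
  have S: "finite A" "A \<noteq> {}" "card A = Suc m" if "A \<in> ?S" for A
    using that V finite_subset by (auto simp: subsets_of_card_def)
  \<comment> \<open>Collections are indexed by natural numbers, so the subsets are enumerated by
    \<open>h\<close>, with inverse \<open>?e\<close>.\<close>
  obtain h where h: "bij_betw h ?S {0..<card ?S}"
    using ex_bij_betw_finite_nat[OF finS] by blast
  let ?e = "inv_into ?S h"
  have e: "?e i \<in> ?S" if "i \<in> {0..<card ?S}" for i
    using h that by (metis bij_betw_imp_surj_on inv_into_into)
  have eh: "?e (h A) = A" "h A \<in> {0..<card ?S}" if "A \<in> ?S" for A
    using h that by (auto simp: bij_betw_def inv_into_f_f)
  define P where "P i = measure_pmf (pmf_of_set (?e i))" for i
  have "\<exists>(Q :: (nat \<Rightarrow> real) measure) X'. is_coupling borel {0..<card ?S} P (\<lambda>_ x. x) Q X' \<and>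
      (\<forall>i\<in>{0..<card ?S}. \<forall>j\<in>{0..<card ?S}. i \<noteq> j \<longrightarrow>
         measure Q {\<omega> \<in> space Q. X' i \<omega> \<noteq> X' j \<omega>} \<le> f (tv_dist borel (P i) (\<lambda>x. x) (P j) (\<lambda>x. x)))"
    using f measurable_diagonal_borel unfolding disagreement_bound_def
    by (elim conjE allE[of _ borel] allE[of _ "{0..<card ?S}"] allE[of _ P] allE[of _ "\<lambda>_ x. x"])
       (auto simp: P_def prob_space_measure_pmf)
  then obtain Q :: "(nat \<Rightarrow> real) measure" and X' where
    coup: "is_coupling borel {0..<card ?S} P (\<lambda>_ x. x) Q X'" and
    dis: "\<And>i j. i \<in> {0..<card ?S} \<Longrightarrow> j \<in> {0..<card ?S} \<Longrightarrow> i \<noteq> j \<Longrightarrow>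
      measure Q {\<omega> \<in> space Q. X' i \<omega> \<noteq> X' j \<omega>} \<le> f (tv_dist borel (P i) (\<lambda>x. x) (P j) (\<lambda>x. x))"
    by blast
  interpret prob_space Q using coup by (simp add: is_coupling_def)
  define X where "X A = X' (h A)" for A
  have rv: "X A \<in> borel_measurable Q" if "A \<in> ?S" for A
    using coup eh[OF that] by (auto simp: is_coupling_def X_def)
  have law: "distr Q borel (X A) = distr (measure_pmf (pmf_of_set A)) borel (\<lambda>x. x)" if "A \<in> ?S" for A
    using coup eh[OF that] by (auto simp: is_coupling_def X_def P_def)
  \<comment> \<open>A coupling preserves only laws, so membership in \<open>A\<close> is obtained
    almost surely, through the distribution.\<close>
  have mem: "AE \<omega> in Q. X A \<omega> \<in> A" if A: "A \<in> ?S" for A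
  proof -
    have borelA: "A \<in> sets borel" using S[OF A] by (simp add: borel_closed finite_imp_closed)
    have "AE x in measure_pmf (pmf_of_set A). x \<in> A"
      using S[OF A] by (simp add: AE_measure_pmf_iff)
    then have "AE x in distr Q borel (X A). x \<in> A"
      unfolding law[OF A] using borelA by (subst AE_distr_iff) auto
    then show ?thesis using rv[OF A] borelA by (subst (asm) AE_distr_iff) auto
  qed
  let ?W = "{(A, B). A \<in> ?S \<and> B \<in> ?S \<and> card (A \<inter> B) = 1}"
  have agree: "?g \<le> prob {\<omega> \<in> space Q. X A \<omega> = X B \<omega>}"
    if A: "A \<in> ?S" and B: "B \<in> ?S" and AB: "card (A \<inter> B) = 1" for A B
  proof -
    \<comment> \<open>The bound on disagreement speaks of distinct indices; \<open>m > 0\<close>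
      makes \<open>A\<close> larger than the one-point intersection.\<close>
    have "A \<noteq> B" using AB S(3)[OF A] m by auto
    then have "h A \<noteq> h B" using eh A B by metis
    then have "prob {\<omega> \<in> space Q. X A \<omega> \<noteq> X B \<omega>} \<le> f (1 - 1 / real (Suc m))"
      using dis[of "h A" "h B"] eh A B S tv_dist_uniform[of A B "Suc m"] AB
      by (simp add: X_def P_def)
    moreover have "{\<omega> \<in> space Q. X A \<omega> = X B \<omega>} \<in> events"
      using rv[OF A] rv[OF B] by measurable
    then have "prob {\<omega> \<in> space Q. X A \<omega> \<noteq> X B \<omega>} = 1 - prob {\<omega> \<in> space Q. X A \<omega> = X B \<omega>}"
      by (rule prob_neg)
    ultimately show ?thesis by linarith
  qed
  \<comment> \<open>Since \<open>f\<close> is at most 1, the number of pairs may be replaced by its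
    lower bound.\<close>
  have "?g \<ge> 0" using f by (auto simp: disagreement_bound_def Pi_iff)
  then have "?g * (real (card V) * real (card V - 1 choose m) * real (card V - Suc m choose m))
      \<le> ?g * real (card ?W)"
    using card_pairs_meeting_once_ge[OF V, of m]
    by (intro mult_left_mono) (simp_all only: of_nat_mult[symmetric] of_nat_le_iff)
  also have "\<dots> = (\<Sum>(A, B)\<in>?W. ?g)" by (simp add: case_prod_beta mult.commute)
  also have "\<dots> \<le> (\<Sum>(A, B)\<in>?W. prob {\<omega> \<in> space Q. X A \<omega> = X B \<omega>})"
    using agree by (intro sum_mono) auto
  also have "\<dots> \<le> (\<Sum>i<card V. (real (i choose m))\<^sup>2)"
    using rv mem by (intro sum_prob_agree_le V prob_space_axioms) auto
  finally show ?thesis .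
qed

lemma one_minus_disagreement_bound_le:
  assumes f: "disagreement_bound f" and m: "m > 0" and k: "k > 0"
  shows "(2 * real m + 1) * (1 - f (1 - 1 / real (Suc m))) \<le> (real (2 * m + 1 + k) / real k) ^ (2 * m)"
proof -
  let ?g = "1 - f (1 - 1 / real (Suc m))"
  \<comment> \<open>With this \<open>N\<close>, \<open>N - Suc m\<close> is \<open>m + k\<close> and
    \<open>N - 1\<close> is \<open>2 * m + k\<close>, so both binomials, times
    \<open>fact m\<close>, are at least \<open>k ^ m\<close>.\<close>
  define N where "N = 2 * m + 1 + k"
  have g0: "?g \<ge> 0" using f by (auto simp: disagreement_bound_def Pi_iff)
  have "N = card (real ` {..<N})" by (simp add: card_image)
  then have count: "?g * (real N * real (N - 1 choose m) * real (N - Suc m choose m))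
      \<le> (\<Sum>i<N. (real (i choose m))\<^sup>2)"
    using disagreement_bound_counting[OF f _ m, of "real ` {..<N}"] by simp
  have "real (k ^ m) \<le> real (fact m * (m + k choose m))"
    by (intro of_nat_mono power_le_fact_times_binomial)
  then have k1: "real k ^ m \<le> fact m * real (N - Suc m choose m)" by (simp add: N_def)
  have "(m + k choose m) \<le> (2 * m + k choose m)" by (rule binomial_mono_left) simp
  then have k2: "real k ^ m \<le> fact m * real (N - 1 choose m)"
    using k1 by (auto simp: N_def elim!: order_trans intro!: mult_left_mono)
  have "real k ^ (2 * m) = real k ^ m * real k ^ m" by (simp add: power_add[symmetric] mult_2)
  also have "\<dots> \<le> (fact m * real (N - 1 choose m)) * (fact m * real (N - Suc m choose m))"
    using k1 k2 by (intro mult_mono) auto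
  finally have "(2 * real m + 1) * ?g * real N * real k ^ (2 * m)
      \<le> (2 * real m + 1) * ?g * real N * ((fact m * real (N - 1 choose m)) * (fact m * real (N - Suc m choose m)))"
    using g0 by (intro mult_left_mono) auto
  also have "\<dots> = (2 * real m + 1) * (fact m)\<^sup>2 * (?g * (real N * real (N - 1 choose m) * real (N - Suc m choose m)))"
    by (simp only: power2_eq_square mult_ac)
  also have "\<dots> \<le> (2 * real m + 1) * (fact m)\<^sup>2 * (\<Sum>i<N. (real (i choose m))\<^sup>2)"
    using count by (intro mult_left_mono) auto
  also have "\<dots> = (2 * real m + 1) * (\<Sum>i<N. (fact m * real (i choose m))\<^sup>2)"
    by (simp add: sum_distrib_left power_mult_distrib mult_ac)
  also have "\<dots> \<le> real N ^ Suc (2 * m)" by (rule sum_binomial_squared_le)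
  finally have "real N * ((2 * real m + 1) * ?g * real k ^ (2 * m)) \<le> real N * real N ^ (2 * m)"
    by (simp only: power_Suc mult_ac)
  \<comment> \<open>One factor \<open>N\<close> cancels, leaving equal powers of \<open>N\<close>
    and \<open>k\<close>, whose ratio tends to 1.\<close>
  then have "(2 * real m + 1) * ?g * real k ^ (2 * m) \<le> real N ^ (2 * m)"
    by (rule mult_left_le_imp_le) (simp add: N_def)
  then show ?thesis using k by (simp add: N_def power_divide pos_le_divide_eq)
qed

theorem proposition12:
  fixes f :: "real \<Rightarrow> real" and n :: nat
  assumes "disagreement_bound f" and "n \<ge> 2"
  shows "f (1 - 1 / real n) \<ge> (2 * real n - 2) / (2 * real n - 1) \<and>
         (2 * real n - 2) / (2 * real n - 1) = F (1 - 1 / real n)"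
proof
  obtain m where n: "n = Suc m" and m: "m > 0" using assms(2) by (cases n) auto
  \<comment> \<open>Let \<open>k\<close> tend to infinity: \<open>N / k\<close> equals
    \<open>1 + (2 * m + 1) / k\<close>, so the upper bound tends to 1.\<close>
  have "(\<lambda>k. real (2 * m + 1) / real k) \<longlonglongrightarrow> 0" by (rule lim_const_over_n)
  then have "(\<lambda>k. (1 + real (2 * m + 1) / real k) ^ (2 * m)) \<longlonglongrightarrow> (1 + 0) ^ (2 * m)"
    by (intro tendsto_intros)
  moreover have "(2 * real m + 1) * (1 - f (1 - 1 / real n)) \<le> (1 + real (2 * m + 1) / real k) ^ (2 * m)"
    if "k \<ge> 1" for k
    using one_minus_disagreement_bound_le[OF assms(1) m, of k] that
    by (simp add: n add_divide_distrib add_ac)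
  ultimately have "(2 * real m + 1) * (1 - f (1 - 1 / real n)) \<le> 1"
    by (intro LIMSEQ_le_const) auto
  then show "f (1 - 1 / real n) \<ge> (2 * real n - 2) / (2 * real n - 1)"
    by (simp add: n field_simps)
  show "(2 * real n - 2) / (2 * real n - 1) = F (1 - 1 / real n)"
    using assms(2) by (simp add: F_def field_simps)
qed

end
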